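(* For every $k\in\mathbb{N}$, the number of negative eigenvalues of the Hessian operator $A_{x_k}$ of $\mathcal{B}$ at the critical point $x_k$, called the Morse index of $x_k$, is odd and given by $$\mathrm{Ind}(x_k)=2k-1 .$$
   Context: $\mathbb{N}=\{1,2,3,\dots\}$. Let $\mathbb{S}^1=\mathbb{R}/\mathbb{Z}$, let $\langle\cdot,\cdot\rangle$, $\|\cdot\|$ be the $L^2$ inner product and norm on $L^2(\mathbb{S}^1,\mathbb{R})$, and $\mathcal{B}\colon W^{1,2}(\mathbb{S}^1,\mathbb{R})\setminus\{0\}\to(0,\infty)$, $\mathcal{B}(x)=2\|x\|^2\|x'\|^2+\frac{1}{\|x\|^2}$. For $k\in\mathbb{N}$ let $c_k=\frac{1}{2^{1/6}(\pi k)^{1/3}}$ and $x_k(\tau)=c_k\cos 2\pi k\tau$, a critical point of $\mathcal{B}$. For a critical point $x$ of $\mathcal{B}$ put $\alpha_x=\frac{\|x'\|^2}{\|x\|^2}-\frac{1}{2\|x\|^6}$; the Hessian operator of $\mathcal{B}$ at $x$ with respect to the inner product $\langle\cdot,\cdot\rangle_x=4\|x\|^2\langle\cdot,\cdot\rangle$ is $A_x\colon W^{2,2}(\mathbb{S}^1,\mathbb{R})\to L^2(\mathbb{S}^1,\mathbb{R})$, $A_x\xi=-\xi''+\alpha_x\xi-\frac{2}{\|x\|^2}\left(2\alpha_x-\frac{1}{\|x\|^6}\right)\langle x,\xi\rangle x$. Eigenvalues are counted with multiplicity. *)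

theory Defs
  imports "HOL-Analysis.Analysis" "HOL-Library.Extended_Nat"
begin

section \<open>The real Hilbert space of square integrable functions on the circle\<close>

text \<open>
  Functions on \<open>\<real>/\<int>\<close> are represented by 1-periodic functions on \<open>\<real>\<close>; integrals over the circle
  are integrals over the fundamental domain \<open>{0..1}\<close> (the double end point is a null set).
\<close>

abbreviation circle :: "real measure"
  where "circle \<equiv> lebesgue_on {0..1}"

definition periodic :: "(real \<Rightarrow> real) \<Rightarrow> bool"
  where "periodic f \<longleftrightarrow> (\<forall>t. f (t + 1) = f t)"

definition sq_integrable :: "(real \<Rightarrow> real) \<Rightarrow> bool"
  where "sq_integrable f \<longleftrightarrow>
    periodic f \<and> f \<in> borel_measurable circle \<and> integrable circle (\<lambda>t. (f t)\<^sup>2)"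

lemma sq_integrable_0: "sq_integrable (\<lambda>_. 0)"
  by (simp add: sq_integrable_def periodic_def)

lemma sq_integrable_integrable_mult:
  assumes "sq_integrable f" "sq_integrable g"
  shows "integrable circle (\<lambda>t. f t * g t)"
proof (rule Bochner_Integration.integrable_bound)
  show "integrable circle (\<lambda>t. (f t)\<^sup>2 + (g t)\<^sup>2)"
    using assms by (auto simp: sq_integrable_def)
  show "(\<lambda>t. f t * g t) \<in> borel_measurable circle"
    using assms by (auto simp: sq_integrable_def)
  have "\<bar>a * b\<bar> \<le> a\<^sup>2 + b\<^sup>2" for a b :: real
  proof -
    have "2 * (\<bar>a\<bar> * \<bar>b\<bar>) \<le> a\<^sup>2 + b\<^sup>2"
      using sum_squares_bound[of "\<bar>a\<bar>" "\<bar>b\<bar>"] by simp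
    moreover have "0 \<le> \<bar>a\<bar> * \<bar>b\<bar>" by simp
    ultimately show ?thesis by (simp only: abs_mult)
  qed
  then show "AE t in circle. norm (f t * g t) \<le> norm ((f t)\<^sup>2 + (g t)\<^sup>2)"
    by (simp del: abs_mult)
qed

lemma sq_integrable_add:
  assumes "sq_integrable f" "sq_integrable g"
  shows "sq_integrable (\<lambda>t. f t + g t)"
proof -
  have "integrable circle (\<lambda>t. (f t)\<^sup>2 + (g t)\<^sup>2 + 2 * (f t * g t))"
    using assms sq_integrable_integrable_mult[OF assms]
    by (intro Bochner_Integration.integrable_add Bochner_Integration.integrable_mult_right)
      (auto simp: sq_integrable_def)
  then have "integrable circle (\<lambda>t. (f t + g t)\<^sup>2)"
    by (simp add: power2_sum algebra_simps)
  then show ?thesis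
    using assms by (auto simp: sq_integrable_def periodic_def)
qed

lemma sq_integrable_cmult:
  assumes "sq_integrable f"
  shows "sq_integrable (\<lambda>t. c * f t)"
  using assms by (auto simp: sq_integrable_def periodic_def power_mult_distrib)

lemma sq_integrable_uminus: "sq_integrable f \<Longrightarrow> sq_integrable (\<lambda>t. - f t)"
  using sq_integrable_cmult[of f "-1"] by simp

lemma sq_integrable_diff:
  "sq_integrable f \<Longrightarrow> sq_integrable g \<Longrightarrow> sq_integrable (\<lambda>t. f t - g t)"
  using sq_integrable_add[OF _ sq_integrable_uminus, of f g] by simp

lemma sq_integrable_continuous:
  assumes "periodic f" "continuous_on UNIV f"
  shows "sq_integrable f"
proof -
  have c: "continuous_on {0..1} f"
    using assms(2) continuous_on_subset by blast
  then have "f \<in> borel_measurable circle"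
    by (intro continuous_imp_measurable_on_sets_lebesgue) auto
  moreover have "integrable circle (\<lambda>t. (f t)\<^sup>2)"
    by (intro continuous_imp_integrable_real continuous_intros c)
  ultimately show ?thesis
    using assms(1) by (simp add: sq_integrable_def)
qed

text \<open>The type \<open>l2\<close> consists of square integrable functions modulo equality almost everywhere.\<close>

definition l2_rel :: "(real \<Rightarrow> real) \<Rightarrow> (real \<Rightarrow> real) \<Rightarrow> bool"
  where "l2_rel f g \<longleftrightarrow> sq_integrable f \<and> sq_integrable g \<and> (AE t in circle. f t = g t)"

quotient_type l2 = "real \<Rightarrow> real" / partial: l2_rel
  morphisms rep_l2 L2
proof (rule part_equivpI)
  show "\<exists>f. l2_rel f f"
    using sq_integrable_0 by (auto simp: l2_rel_def)
  show "symp l2_rel"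
    by (auto simp: symp_def l2_rel_def)
  show "transp l2_rel"
    unfolding transp_def l2_rel_def by (auto elim: AE_mp)
qed

instantiation l2 :: real_vector
begin

lift_definition zero_l2 :: l2 is "\<lambda>_. 0"
  by (simp add: l2_rel_def sq_integrable_0)

lift_definition plus_l2 :: "l2 \<Rightarrow> l2 \<Rightarrow> l2" is "\<lambda>f g t. f t + g t"
  unfolding l2_rel_def by (auto simp: sq_integrable_add elim: AE_mp)

lift_definition minus_l2 :: "l2 \<Rightarrow> l2 \<Rightarrow> l2" is "\<lambda>f g t. f t - g t"
  unfolding l2_rel_def by (auto simp: sq_integrable_diff elim: AE_mp)

lift_definition uminus_l2 :: "l2 \<Rightarrow> l2" is "\<lambda>f t. - f t"
  unfolding l2_rel_def by (auto simp: sq_integrable_uminus)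

lift_definition scaleR_l2 :: "real \<Rightarrow> l2 \<Rightarrow> l2" is "\<lambda>c f t. c * f t"
  unfolding l2_rel_def by (auto simp: sq_integrable_cmult)

instance
proof
  fix x y z :: l2 and a b :: real
  show "x + y + z = x + (y + z)"
    by transfer (auto simp: l2_rel_def algebra_simps intro!: sq_integrable_add)
  show "x + y = y + x"
    by transfer (auto simp: l2_rel_def algebra_simps intro!: sq_integrable_add)
  show "0 + x = x"
    by transfer (auto simp: l2_rel_def)
  show "- x + x = 0"
    by transfer (auto simp: l2_rel_def sq_integrable_0)
  show "x - y = x + - y"
    by transfer (auto simp: l2_rel_def intro!: sq_integrable_diff)
  show "a *\<^sub>R (x + y) = a *\<^sub>R x + a *\<^sub>R y"
    by transfer (auto simp: l2_rel_def algebra_simps intro!: sq_integrable_add sq_integrable_cmult)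
  show "(a + b) *\<^sub>R x = a *\<^sub>R x + b *\<^sub>R x"
    by transfer (auto simp: l2_rel_def algebra_simps intro!: sq_integrable_add sq_integrable_cmult)
  show "a *\<^sub>R b *\<^sub>R x = (a * b) *\<^sub>R x"
    by transfer (auto simp: l2_rel_def algebra_simps intro!: sq_integrable_cmult)
  show "1 *\<^sub>R x = x"
    by transfer (auto simp: l2_rel_def)
qed

end

instantiation l2 :: real_inner
begin

lift_definition inner_l2 :: "l2 \<Rightarrow> l2 \<Rightarrow> real" is "\<lambda>f g. integral\<^sup>L circle (\<lambda>t. f t * g t)"
  unfolding l2_rel_def
proof (clarify, rule integral_cong_AE)
  fix f f' g g' :: "real \<Rightarrow> real"
  assume "sq_integrable f" "sq_integrable f'" "sq_integrable g" "sq_integrable g'"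
  then show "(\<lambda>t. f t * g t) \<in> borel_measurable circle" "(\<lambda>t. f' t * g' t) \<in> borel_measurable circle"
    by (auto simp: sq_integrable_def)
qed auto

definition norm_l2 :: "l2 \<Rightarrow> real" where "norm_l2 x = sqrt (inner x x)"
definition dist_l2 :: "l2 \<Rightarrow> l2 \<Rightarrow> real" where "dist_l2 x y = norm (x - y)"
definition sgn_l2 :: "l2 \<Rightarrow> l2" where "sgn_l2 x = x /\<^sub>R norm x"
definition uniformity_l2 :: "(l2 \<times> l2) filter"
  where "uniformity_l2 = (INF e\<in>{0 <..}. principal {(x, y). dist x y < e})"
definition open_l2 :: "l2 set \<Rightarrow> bool"
  where "open_l2 S = (\<forall>x\<in>S. \<forall>\<^sub>F (x', y) in uniformity. x' = x \<longrightarrow> y \<in> S)"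

instance
proof
  fix x y z :: l2 and a :: real
  show "dist x y = norm (x - y)" by (rule dist_l2_def)
  show "sgn x = x /\<^sub>R norm x" by (rule sgn_l2_def)
  show "uniformity = (INF e\<in>{0 <..}. principal {(x, y :: l2). dist x y < e})"
    by (rule uniformity_l2_def)
  show "open S = (\<forall>x\<in>S. \<forall>\<^sub>F (x', y) in uniformity. x' = x \<longrightarrow> y \<in> S)" for S :: "l2 set"
    by (rule open_l2_def)
  show "inner x y = inner y x"
    by transfer (simp add: mult.commute)
  show "inner (x + y) z = inner x z + inner y z"
    by transfer (simp add: l2_rel_def distrib_right sq_integrable_integrable_mult)
  show "inner (a *\<^sub>R x) y = a * inner x y"
    by transfer (simp add: mult.assoc)
  show "0 \<le> inner x x"
    by transfer simp
  show "inner x x = 0 \<longleftrightarrow> x = 0"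
  proof transfer
    fix f assume "l2_rel f f"
    then have f: "sq_integrable f" by (simp add: l2_rel_def)
    have "integral\<^sup>L circle (\<lambda>t. f t * f t) = 0 \<longleftrightarrow> (AE t in circle. f t * f t = 0)"
      by (intro integral_nonneg_eq_0_iff_AE sq_integrable_integrable_mult f) simp
    then show "integral\<^sup>L circle (\<lambda>t. f t * f t) = 0 \<longleftrightarrow> l2_rel f (\<lambda>_. 0)"
      using f sq_integrable_0 by (simp add: l2_rel_def)
  qed
  show "norm x = sqrt (inner x x)" by (rule norm_l2_def)
qed

end

lemma l2_cases:
  obtains f where "sq_integrable f" "x = L2 f"
proof -
  have "l2_rel (rep_l2 x) (rep_l2 x)" "L2 (rep_l2 x) = x"
    using Quotient3_rep_reflp[OF Quotient3_l2] Quotient3_abs_rep[OF Quotient3_l2] by auto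
  then show thesis
    using that[of "rep_l2 x"] by (simp add: l2_rel_def)
qed

lemma L2_eq_iff:
  "sq_integrable f \<Longrightarrow> sq_integrable g \<Longrightarrow> L2 f = L2 g \<longleftrightarrow> (AE t in circle. f t = g t)"
  using Quotient3_rel[OF Quotient3_l2, of f g] by (auto simp: l2_rel_def)

lemma inner_L2:
  "sq_integrable f \<Longrightarrow> sq_integrable g \<Longrightarrow> inner (L2 f) (L2 g) = integral\<^sup>L circle (\<lambda>t. f t * g t)"
  by (simp add: inner_l2.abs_eq l2_rel_def)

lemma diff_L2:
  "sq_integrable f \<Longrightarrow> sq_integrable g \<Longrightarrow> L2 f - L2 g = L2 (\<lambda>t. f t - g t)"
  by (simp add: minus_l2.abs_eq l2_rel_def)

lemma scaleR_L2: "sq_integrable f \<Longrightarrow> c *\<^sub>R L2 f = L2 (\<lambda>t. c * f t)"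
  by (simp add: scaleR_l2.abs_eq l2_rel_def)


section \<open>Sobolev spaces\<close>

definition test_fun :: "(real \<Rightarrow> real) \<Rightarrow> bool"
  where "test_fun \<phi> \<longleftrightarrow> periodic \<phi> \<and> (\<forall>n t. (deriv ^^ n) \<phi> differentiable at t)"

definition has_weak_deriv :: "l2 \<Rightarrow> l2 \<Rightarrow> bool"
  where "has_weak_deriv x y \<longleftrightarrow>
    (\<forall>\<phi>. test_fun \<phi> \<longrightarrow> inner x (L2 (deriv \<phi>)) = - inner y (L2 \<phi>))"

text \<open>The weak derivative is unique by \<open>has_weak_deriv_unique\<close> below; \<open>wderiv\<close> is meaningful on \<open>W12\<close> only.\<close>

definition wderiv :: "l2 \<Rightarrow> l2"
  where "wderiv x = (THE y. has_weak_deriv x y)"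

definition W12 :: "l2 set"
  where "W12 = {x. \<exists>y. has_weak_deriv x y}"

definition W22 :: "l2 set"
  where "W22 = {x \<in> W12. wderiv x \<in> W12}"

inductive trig :: "(real \<Rightarrow> real) \<Rightarrow> bool" where
  const: "trig (\<lambda>_. c)"
| cos: "trig (\<lambda>t. cos (2 * pi * t))"
| sin: "trig (\<lambda>t. sin (2 * pi * t))"
| add: "trig f \<Longrightarrow> trig g \<Longrightarrow> trig (\<lambda>t. f t + g t)"
| mult: "trig f \<Longrightarrow> trig g \<Longrightarrow> trig (\<lambda>t. f t * g t)"

lemma trig_cmult: "trig f \<Longrightarrow> trig (\<lambda>t. c * f t)"
  by (intro trig.mult trig.const)

lemma trig_diff: "trig f \<Longrightarrow> trig g \<Longrightarrow> trig (\<lambda>t. f t - g t)"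
  using trig.add[OF _ trig_cmult[of g "-1"], of f] by simp

lemma trig_periodic: "trig f \<Longrightarrow> periodic f"
  by (induction rule: trig.induct)
    (auto simp: periodic_def distrib_left)

lemma trig_deriv_ex: "trig f \<Longrightarrow> \<exists>f'. trig f' \<and> (\<forall>t. (f has_real_derivative f' t) (at t))"
proof (induction rule: trig.induct)
  case (const c)
  then show ?case by (intro exI[of _ "\<lambda>_. 0"]) (auto intro: trig.const)
next
  case cos
  show ?case
    by (intro exI[of _ "\<lambda>t. - (2 * pi) * sin (2 * pi * t)"] conjI trig_cmult trig.sin)
      (auto intro!: derivative_eq_intros)
next
  case sin
  show ?case
    by (intro exI[of _ "\<lambda>t. (2 * pi) * cos (2 * pi * t)"] conjI trig_cmult trig.cos)
      (auto intro!: derivative_eq_intros)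
next
  case (add f g)
  then obtain f' g' where "trig f'" "trig g'" and
    "\<And>t. (f has_real_derivative f' t) (at t)" "\<And>t. (g has_real_derivative g' t) (at t)"
    by auto
  then show ?case
    by (intro exI[of _ "\<lambda>t. f' t + g' t"]) (auto intro: trig.add intro!: derivative_eq_intros)
next
  case (mult f g)
  then obtain f' g' where "trig f'" "trig g'" and
    "\<And>t. (f has_real_derivative f' t) (at t)" "\<And>t. (g has_real_derivative g' t) (at t)"
    by auto
  with mult.hyps show ?case
    by (intro exI[of _ "\<lambda>t. f' t * g t + g' t * f t"])
      (auto intro!: trig.add trig.mult derivative_eq_intros)
qed

lemma trig_deriv:
  assumes "trig f"
  shows "trig (deriv f)" "(f has_real_derivative deriv f t) (at t)"
proof -
  obtain f' where f': "trig f'" "\<And>t. (f has_real_derivative f' t) (at t)"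
    using trig_deriv_ex[OF assms] by blast
  then have "deriv f = f'" by (auto intro: DERIV_imp_deriv)
  with f' show "trig (deriv f)" "(f has_real_derivative deriv f t) (at t)" by auto
qed

lemma trig_test_fun:
  assumes "trig f"
  shows "test_fun f"
proof -
  have "trig ((deriv ^^ n) f)" for n
    by (induction n) (auto simp: assms trig_deriv)
  then show ?thesis
    unfolding test_fun_def using trig_periodic[OF assms] trig_deriv(2)
    by (blast intro: differentiableI[OF has_field_derivative_imp_has_derivative])
qed

lemma trig_cos_sin_mult:
  "trig (\<lambda>t. cos (2 * pi * real n * t)) \<and> trig (\<lambda>t. sin (2 * pi * real n * t))"
proof (induction n)
  case 0
  show ?case by (simp add: trig.const)
next
  case (Suc n)
  have "trig (\<lambda>t. cos (2 * pi * real n * t) * cos (2 * pi * t) -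
      sin (2 * pi * real n * t) * sin (2 * pi * t))"
    "trig (\<lambda>t. sin (2 * pi * real n * t) * cos (2 * pi * t) +
      cos (2 * pi * real n * t) * sin (2 * pi * t))"
    using Suc by (auto intro!: trig.add trig_diff trig.mult trig.cos trig.sin)
  moreover have "2 * pi * real (Suc n) * t = 2 * pi * real n * t + 2 * pi * t" for t
    by (simp add: algebra_simps)
  ultimately show ?case
    by (simp add: cos_add sin_add trig_diff)
qed

lemma test_fun_continuous:
  assumes "test_fun \<phi>"
  shows "continuous_on UNIV \<phi>" "continuous_on UNIV (deriv \<phi>)"
    "(\<phi> has_real_derivative deriv \<phi> t) (at t)"
proof -
  have d: "\<phi> differentiable at t" "deriv \<phi> differentiable at t" for t
  proof -
    have "(deriv ^^ n) \<phi> differentiable at t" for n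
      using assms by (simp add: test_fun_def)
    from this[of 0] this[of 1] show "\<phi> differentiable at t" "deriv \<phi> differentiable at t"
      by simp_all
  qed
  show "continuous_on UNIV \<phi>" "continuous_on UNIV (deriv \<phi>)"
    using d by (auto intro!: continuous_at_imp_continuous_on differentiable_imp_continuous_within)
  show "(\<phi> has_real_derivative deriv \<phi> t) (at t)"
    using d by (simp add: DERIV_deriv_iff_real_differentiable)
qed

lemma periodic_deriv:
  assumes "periodic f" "\<And>t. (f has_real_derivative f' t) (at t)"
  shows "periodic f'"
  unfolding periodic_def
proof
  fix t
  have "((\<lambda>s. f (s + 1)) has_real_derivative f' (t + 1)) (at t)"
    using assms(2)[of "t + 1"] by (simp add: DERIV_shift)
  then show "f' (t + 1) = f' t"
    using assms DERIV_unique[of f "f' (t + 1)" t "f' t"] by (simp add: periodic_def)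
qed

lemma test_fun_sq_integrable:
  assumes "test_fun \<phi>"
  shows "sq_integrable \<phi>" "sq_integrable (deriv \<phi>)"
  using assms test_fun_continuous[OF assms] periodic_deriv[of \<phi> "deriv \<phi>"]
  by (auto intro!: sq_integrable_continuous simp: test_fun_def)

lemma trig_polynomial:
  assumes "real_polynomial_function (p :: complex \<Rightarrow> real)"
  shows "trig (\<lambda>t. p (cis (2 * pi * t)))"
  using assms
proof (induction rule: real_polynomial_function.induct)
  case (linear f)
  have "f (cis a) = f 1 * cos a + f \<i> * sin a" for a
  proof -
    have "cis a = cos a *\<^sub>R 1 + sin a *\<^sub>R \<i>"
      by (simp add: complex_eq_iff)
    then show ?thesis
      using linear by (simp only: linear_simps(1,5)) (simp add: mult.commute)
  qed
  then show ?case
    by (simp only:) (intro trig.add trig_cmult trig.cos trig.sin)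
qed (auto intro: trig.intros)

text \<open>
  Trigonometric polynomials, hence test functions, separate the points of \<open>l2\<close>: approximate the
  sign of \<open>f\<close> by continuous functions on the unit circle and these by polynomials.
\<close>

lemma l2_eq_0I:
  assumes orth: "\<And>\<phi>. trig \<phi> \<Longrightarrow> inner x (L2 \<phi>) = 0"
  shows "x = 0"
proof -
  obtain f where f: "sq_integrable f" and x: "x = L2 f" by (rule l2_cases)
  have fm: "f \<in> borel_measurable circle" using f by (simp add: sq_integrable_def)
  define s where "s t = (if t \<in> {0..1} then sgn (f t) else 0)" for t
  have "(\<lambda>t. sgn (f t)) \<in> borel_measurable circle"
    using fm by measurable
  then have "s \<in> borel_measurable lebesgue"
    unfolding s_def by (subst (asm) borel_measurable_if[symmetric]) auto
  then have "s measurable_on {0..1}"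
    by (rule lebesgue_measurable_imp_measurable_on) simp
  then obtain N h where N: "negligible N" and h: "\<And>n. continuous_on UNIV (h n)"
    and lim: "\<And>t. t \<notin> N \<Longrightarrow> (\<lambda>n. h n t) \<longlonglongrightarrow> (if t \<in> {0..1} then s t else 0)"
    unfolding measurable_on_def by blast
  define w where "w n z = min 1 (real n * norm (z - 1))" for n and z :: complex
  define G where "G n z = max (-1) (min 1 (h n (Arg2pi z / (2 * pi)))) * w n z" for n z
  have Gb: "\<bar>G n z\<bar> \<le> \<bar>w n z\<bar>" for n z
  proof -
    have "\<bar>max (-1) (min 1 (a::real))\<bar> \<le> 1" for a by auto
    then show ?thesis
      unfolding G_def abs_mult by (intro mult_left_le_one_le) auto
  qed
  have wb: "0 \<le> w n z" "w n z \<le> 1" for n z by (auto simp: w_def)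
  have cw: "isCont (w n) z" for n z unfolding w_def by (intro continuous_intros)
  have cG: "isCont (G n) z" if "norm z = 1" for n z
  proof (cases "z = 1")
    case True
    have w1: "w n 1 = 0" by (simp add: w_def)
    have "(w n \<longlongrightarrow> 0) (at 1)"
      using cw[where n = n and z = 1] w1 unfolding isCont_def by metis
    then have "(G n \<longlongrightarrow> 0) (at 1)"
      by (rule Lim_null_comparison[rotated])
        (use Gb[of n] wb in \<open>auto intro!: always_eventually simp: abs_of_nonneg\<close>)
    then show ?thesis using True by (simp add: isCont_def G_def w_def)
  next
    case False
    have "z \<notin> \<real>\<^sub>\<ge>\<^sub>0"
      using that False by (auto elim!: nonneg_Reals_cases)
    then have "isCont Arg2pi z" by (rule continuous_at_Arg2pi)
    then have "isCont (\<lambda>z. Arg2pi z / (2 * pi)) z" by (intro continuous_intros) auto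
    moreover have "isCont (h n) y" for y
      using h[of n] by (simp add: continuous_on_eq_continuous_at)
    ultimately have "isCont (\<lambda>z. h n (Arg2pi z / (2 * pi))) z"
      by (rule isCont_o2)
    then show ?thesis
      unfolding G_def by (intro continuous_intros cw)
  qed
  have "\<exists>p. real_polynomial_function p \<and> (\<forall>z\<in>sphere 0 1. \<bar>G n z - p z\<bar> < inverse (real (Suc n)))" for n
    by (rule Stone_Weierstrass_real_polynomial_function[of "sphere 0 1" "G n" "inverse (real (Suc n))"])
      (auto intro!: continuous_at_imp_continuous_on cG)
  then obtain p where p: "\<And>n. real_polynomial_function (p n)"
    and pG: "\<And>n z. norm z = 1 \<Longrightarrow> \<bar>G n z - p n z\<bar> < inverse (real (Suc n))"
    using choice[of "\<lambda>n p. real_polynomial_function p \<and> (\<forall>z\<in>sphere 0 1. \<bar>G n z - p z\<bar> < inverse (real (Suc n)))"]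
    by (metis mem_sphere_0)
  define q where "q n t = p n (cis (2 * pi * t))" for n t
  have q: "trig (q n)" for n
    unfolding q_def by (rule trig_polynomial[OF p])
  have qs: "sq_integrable (q n)" for n
    using q test_fun_sq_integrable trig_test_fun by blast
  have qb: "\<bar>q n t\<bar> \<le> 2" for n t
  proof -
    have "\<bar>G n (cis (2 * pi * t)) - q n t\<bar> < inverse (real (Suc n))"
      unfolding q_def by (rule pG) simp
    moreover have "inverse (real (Suc n)) \<le> 1" by (simp add: field_simps)
    moreover have "\<bar>G n (cis (2 * pi * t))\<bar> \<le> 1"
      using Gb[of n "cis (2 * pi * t)"] wb[of n "cis (2 * pi * t)"] by linarith
    ultimately show ?thesis by linarith
  qed
  have qlim: "(\<lambda>n. q n t) \<longlonglongrightarrow> sgn (f t)" if t: "t \<in> {0<..<1}" "t \<notin> N" for t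
  proof -
    let ?z = "cis (2 * pi * t)"
    have A: "Arg2pi ?z = 2 * pi * t"
      by (rule Arg2pi_unique[of 1]) (use t in \<open>auto simp: cis_conv_exp\<close>)
    have z1: "?z \<noteq> 1"
    proof
      assume "?z = 1"
      then have "Arg2pi ?z = 0" using Arg2pi_of_real[of 1] by simp
      then show False using A t by auto
    qed
    have "(\<lambda>n. h n t) \<longlonglongrightarrow> sgn (f t)"
      using lim[OF t(2)] t(1) by (simp add: s_def)
    then have "(\<lambda>n. max (-1) (min 1 (h n t))) \<longlonglongrightarrow> max (-1) (min 1 (sgn (f t)))"
      by (intro tendsto_intros)
    moreover have "max (-1) (min 1 (sgn (f t))) = sgn (f t)" by (auto simp: sgn_if)
    moreover have "(\<lambda>n. w n ?z) \<longlonglongrightarrow> 1"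
    proof (rule tendsto_eventually)
      have "filterlim (\<lambda>n. norm (?z - 1) * real n) at_top sequentially"
        by (rule filterlim_tendsto_pos_mult_at_top[OF tendsto_const])
          (use z1 in \<open>auto intro: filterlim_real_sequentially\<close>)
      then have "\<forall>\<^sub>F n in sequentially. 1 \<le> norm (?z - 1) * real n"
        by (simp add: filterlim_at_top)
      then show "\<forall>\<^sub>F n in sequentially. w n ?z = 1"
        by eventually_elim (simp add: w_def mult.commute)
    qed
    ultimately have "(\<lambda>n. max (-1) (min 1 (h n t)) * w n ?z) \<longlonglongrightarrow> sgn (f t) * 1"
      by (intro tendsto_mult) simp_all
    then have "(\<lambda>n. G n ?z) \<longlonglongrightarrow> sgn (f t)"
      unfolding G_def A by simp
    moreover have "(\<lambda>n. q n t - G n ?z) \<longlonglongrightarrow> 0"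
    proof (rule Lim_null_comparison[OF _ LIMSEQ_inverse_real_of_nat])
      show "\<forall>\<^sub>F n in sequentially. norm (q n t - G n ?z) \<le> inverse (real (Suc n))"
        using pG[of ?z] by (intro always_eventually allI) (simp add: q_def abs_minus_commute less_imp_le)
    qed
    ultimately have "(\<lambda>n. G n ?z + (q n t - G n ?z)) \<longlonglongrightarrow> sgn (f t) + 0"
      by (rule tendsto_add)
    then show ?thesis by simp
  qed
  have one: "sq_integrable (\<lambda>_. 1)"
    by (rule sq_integrable_continuous) (auto simp: periodic_def)
  have intf: "integrable circle f"
    using sq_integrable_integrable_mult[OF f one] by simp
  have "(\<lambda>n. integral\<^sup>L circle (\<lambda>t. f t * q n t)) \<longlonglongrightarrow> integral\<^sup>L circle (\<lambda>t. f t * sgn (f t))"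
  proof (rule integral_dominated_convergence)
    show "(\<lambda>t. f t * sgn (f t)) \<in> borel_measurable circle" using fm by measurable
    show "(\<lambda>t. f t * q n t) \<in> borel_measurable circle" for n
      using fm qs[of n] by (auto simp: sq_integrable_def)
    show "integrable circle (\<lambda>t. \<bar>f t\<bar> * 2)" using intf by auto
    have "negligible (N \<union> {0, 1})" using N by (simp add: negligible_Un)
    then have "N \<union> {0, 1} \<in> null_sets lebesgue" by (simp add: negligible_iff_null_sets)
    then have "AE t in lebesgue. t \<notin> N \<union> {0, 1}" by (rule AE_not_in)
    then have "AE t in lebesgue. t \<in> {0..1} \<longrightarrow> (\<lambda>n. f t * q n t) \<longlonglongrightarrow> f t * sgn (f t)"
      by eventually_elim (auto intro!: tendsto_mult qlim)
    then show "AE t in circle. (\<lambda>n. f t * q n t) \<longlonglongrightarrow> f t * sgn (f t)"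
      by (subst AE_restrict_space_iff) auto
    show "AE t in circle. norm (f t * q n t) \<le> \<bar>f t\<bar> * 2" for n
      using qb by (intro AE_I2) (auto simp: abs_mult intro!: mult_left_mono)
  qed
  moreover have "integral\<^sup>L circle (\<lambda>t. f t * q n t) = 0" for n
    using orth[OF q[of n]] f qs by (simp add: x inner_L2)
  ultimately have "integral\<^sup>L circle (\<lambda>t. f t * sgn (f t)) = 0"
    by (simp add: LIMSEQ_const_iff)
  then have "integral\<^sup>L circle (\<lambda>t. \<bar>f t\<bar>) = 0"
    by (simp add: abs_sgn)
  then have "AE t in circle. f t = 0"
    using integral_nonneg_eq_0_iff_AE[of circle "\<lambda>t. \<bar>f t\<bar>"] intf by auto
  then show ?thesis
    unfolding x zero_l2_def using f sq_integrable_0 by (simp add: L2_eq_iff)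
qed

lemma has_weak_deriv_unique:
  assumes "has_weak_deriv x y" "has_weak_deriv x z"
  shows "y = z"
proof -
  have "y - z = 0"
    using assms by (intro l2_eq_0I) (auto simp: has_weak_deriv_def inner_diff_left dest!: trig_test_fun)
  then show ?thesis by simp
qed

lemma wderiv_eqI: "has_weak_deriv x y \<Longrightarrow> wderiv x = y"
  unfolding wderiv_def by (rule the_equality) (auto dest: has_weak_deriv_unique)

lemma W12_has_weak_deriv: "x \<in> W12 \<Longrightarrow> has_weak_deriv x (wderiv x)"
  using wderiv_eqI by (auto simp: W12_def)

lemma W12_I: "has_weak_deriv x y \<Longrightarrow> x \<in> W12"
  by (auto simp: W12_def)

lemma has_weak_deriv_add:
  "has_weak_deriv x y \<Longrightarrow> has_weak_deriv x' y' \<Longrightarrow> has_weak_deriv (x + x') (y + y')"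
  by (simp add: has_weak_deriv_def inner_add_left)

lemma has_weak_deriv_scaleR: "has_weak_deriv x y \<Longrightarrow> has_weak_deriv (c *\<^sub>R x) (c *\<^sub>R y)"
  by (simp add: has_weak_deriv_def)

lemma W12_add: "x \<in> W12 \<Longrightarrow> y \<in> W12 \<Longrightarrow> x + y \<in> W12 \<and> wderiv (x + y) = wderiv x + wderiv y"
  using has_weak_deriv_add W12_I wderiv_eqI W12_has_weak_deriv by metis

lemma W12_scaleR: "x \<in> W12 \<Longrightarrow> c *\<^sub>R x \<in> W12 \<and> wderiv (c *\<^sub>R x) = c *\<^sub>R wderiv x"
  using has_weak_deriv_scaleR W12_I wderiv_eqI W12_has_weak_deriv by metis

lemma has_weak_deriv_C1:
  assumes "periodic f" "\<And>t. (f has_real_derivative f' t) (at t)" "continuous_on UNIV f'"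
  shows "has_weak_deriv (L2 f) (L2 f')"
  unfolding has_weak_deriv_def
proof (intro allI impI)
  fix \<phi> assume \<phi>: "test_fun \<phi>"
  note c = test_fun_continuous[OF \<phi>]
  have cf: "continuous_on UNIV f"
    using assms(2) by (auto intro!: continuous_at_imp_continuous_on DERIV_isCont)
  have f: "sq_integrable f" and f': "sq_integrable f'"
    using assms cf periodic_deriv[of f f'] by (auto intro: sq_integrable_continuous)
  have sub: "continuous_on {0..1} g" if "continuous_on UNIV g" for g :: "real \<Rightarrow> real"
    using that continuous_on_subset by blast
  have "((\<lambda>t. f t * deriv \<phi> t + f' t * \<phi> t) has_integral f 1 * \<phi> 1 - f 0 * \<phi> 0) {0..1}"
    by (rule fundamental_theorem_of_calculus)
      (auto simp: has_real_derivative_iff_has_vector_derivative[symmetric]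
        intro!: derivative_eq_intros DERIV_subset[OF assms(2)] DERIV_subset[OF c(3)])
  moreover have "f 1 = f 0" "\<phi> 1 = \<phi> 0"
    using assms(1) \<phi> by (auto simp: periodic_def test_fun_def dest!: spec[of _ 0])
  ultimately have hi: "integral {0..1} (\<lambda>t. f t * deriv \<phi> t + f' t * \<phi> t) = 0"
    by (simp add: integral_unique)
  have i: "integrable circle (\<lambda>t. f t * deriv \<phi> t)" "integrable circle (\<lambda>t. f' t * \<phi> t)"
    using f f' test_fun_sq_integrable[OF \<phi>] by (auto intro: sq_integrable_integrable_mult)
  then have "integral\<^sup>L circle (\<lambda>t. f t * deriv \<phi> t + f' t * \<phi> t) = 0"
    using hi by (subst lebesgue_integral_eq_integral) auto
  then have "integral\<^sup>L circle (\<lambda>t. f t * deriv \<phi> t) = - integral\<^sup>L circle (\<lambda>t. f' t * \<phi> t)"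
    using i by simp
  then show "inner (L2 f) (L2 (deriv \<phi>)) = - inner (L2 f') (L2 \<phi>)"
    using f f' test_fun_sq_integrable[OF \<phi>] by (simp add: inner_L2)
qed


section \<open>The functional, its critical points and its Hessian\<close>

text \<open>
  \<open>action\<close> is meant on \<open>W12 - {0}\<close>, and \<open>hessian x\<close> is the operator with domain \<open>W22\<close>
  for a critical point \<open>x\<close>.
\<close>

definition action :: "l2 \<Rightarrow> real"
  where "action x = 2 * (norm x)\<^sup>2 * (norm (wderiv x))\<^sup>2 + 1 / (norm x)\<^sup>2"

definition critical_point :: "l2 \<Rightarrow> bool"
  where "critical_point x \<longleftrightarrow> x \<in> W12 - {0} \<and>
    (\<forall>\<eta>\<in>W12. ((\<lambda>s. action (x + s *\<^sub>R \<eta>)) has_real_derivative 0) (at 0))"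

definition alpha :: "l2 \<Rightarrow> real"
  where "alpha x = (norm (wderiv x))\<^sup>2 / (norm x)\<^sup>2 - 1 / (2 * norm x ^ 6)"

definition hessian :: "l2 \<Rightarrow> l2 \<Rightarrow> l2"
  where "hessian x \<xi> = - wderiv (wderiv \<xi>) + alpha x *\<^sub>R \<xi>
    - (2 / (norm x)\<^sup>2 * (2 * alpha x - 1 / norm x ^ 6) * inner x \<xi>) *\<^sub>R x"

text \<open>
  Here \<open>A\<close> is a linear operator with domain \<open>D\<close>. The operators \<open>hessian x\<close> are symmetric, so
  multiplicities are dimensions of eigenspaces. As \<open>dim\<close> and \<open>\<Sum>\<close> vanish on infinite objects,
  the infinite cases are sent to \<open>\<infinity>\<close>; an index \<open>enat n\<close> thus includes the claim that there
  are only finitely many negative eigenvalues, each of finite multiplicity.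
\<close>

definition eigenspace :: "'a::real_vector set \<Rightarrow> ('a \<Rightarrow> 'a) \<Rightarrow> real \<Rightarrow> 'a set"
  where "eigenspace D A \<mu> = {\<xi> \<in> D. A \<xi> = \<mu> *\<^sub>R \<xi>}"

definition eigenvalues :: "'a::real_vector set \<Rightarrow> ('a \<Rightarrow> 'a) \<Rightarrow> real set"
  where "eigenvalues D A = {\<mu>. \<exists>\<xi>\<in>D. \<xi> \<noteq> 0 \<and> A \<xi> = \<mu> *\<^sub>R \<xi>}"

definition multiplicity_of :: "'a::real_vector set \<Rightarrow> ('a \<Rightarrow> 'a) \<Rightarrow> real \<Rightarrow> enat"
  where "multiplicity_of D A \<mu> =
    (if \<exists>B. finite B \<and> eigenspace D A \<mu> \<subseteq> span B then enat (dim (eigenspace D A \<mu>)) else \<infinity>)"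

definition morse_index :: "l2 \<Rightarrow> enat"
  where "morse_index x =
    (let N = {\<mu> \<in> eigenvalues W22 (hessian x). \<mu> < 0}
     in if finite N then \<Sum>\<mu>\<in>N. multiplicity_of W22 (hessian x) \<mu> else \<infinity>)"

definition amp :: "nat \<Rightarrow> real"
  where "amp k = 1 / (2 powr (1/6) * (pi * real k) powr (1/3))"

definition x_crit :: "nat \<Rightarrow> l2"
  where "x_crit k = L2 (\<lambda>\<tau>. amp k * cos (2 * pi * real k * \<tau>))"


text \<open>
  \<open>x_crit k\<close> is critical, and at a critical point \<open>hessian\<close> represents the second variation of
  \<open>action\<close> with respect to the inner product \<open>4 * (norm x)\<^sup>2 * inner \<xi> \<eta>\<close>, tested against smooth \<open>\<eta>\<close>.
\<close>

definition first_variation :: "l2 \<Rightarrow> l2 \<Rightarrow> real"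
  where "first_variation x \<eta> =
    4 * inner x \<eta> * inner (wderiv x) (wderiv x) + 4 * inner x x * inner (wderiv x) (wderiv \<eta>)
    - 2 * inner x \<eta> / (inner x x)\<^sup>2"

lemma action_has_derivative:
  assumes "x \<in> W12" "x \<noteq> 0" "\<eta> \<in> W12"
  shows "((\<lambda>s. action (x + s *\<^sub>R \<eta>)) has_real_derivative first_variation x \<eta>) (at 0)"
proof -
  define N D b d e f where defs: "N = inner x x" "D = inner (wderiv x) (wderiv x)"
    "b = inner x \<eta>" "d = inner (wderiv x) (wderiv \<eta>)"
    "e = inner \<eta> \<eta>" "f = inner (wderiv \<eta>) (wderiv \<eta>)"
  have N: "N \<noteq> 0" using assms by (simp add: defs)
  have "action (x + s *\<^sub>R \<eta>) = 2 * (N + 2 * s * b + s\<^sup>2 * e) * (D + 2 * s * d + s\<^sup>2 * f)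
      + 1 / (N + 2 * s * b + s\<^sup>2 * e)" for s
  proof -
    have "wderiv (x + s *\<^sub>R \<eta>) = wderiv x + s *\<^sub>R wderiv \<eta>"
      using assms W12_add W12_scaleR by simp
    moreover have "(norm (u + s *\<^sub>R v))\<^sup>2 = inner u u + 2 * s * inner u v + s\<^sup>2 * inner v v" for u v :: l2
      unfolding power2_norm_eq_inner
      by (simp add: inner_add_left inner_add_right inner_commute[of v u] power2_eq_square algebra_simps)
    ultimately show ?thesis
      unfolding action_def defs by simp
  qed
  moreover have "((\<lambda>s. 2 * (N + 2 * s * b + s\<^sup>2 * e) * (D + 2 * s * d + s\<^sup>2 * f)
      + 1 / (N + 2 * s * b + s\<^sup>2 * e)) has_real_derivative first_variation x \<eta>) (at 0)"
    unfolding first_variation_def defs[symmetric]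
    using N by (auto intro!: derivative_eq_intros simp: power2_eq_square)
  ultimately show ?thesis by simp
qed

lemma critical_point_iff:
  "critical_point x \<longleftrightarrow> x \<in> W12 - {0} \<and> (\<forall>\<eta>\<in>W12. first_variation x \<eta> = 0)"
  unfolding critical_point_def using action_has_derivative[of x]
  by (metis DERIV_unique Diff_iff singletonI)

lemma critical_point_weak_equation:
  assumes "critical_point x" "\<eta> \<in> W12"
  shows "inner (wderiv x) (wderiv \<eta>) = - alpha x * inner x \<eta>"
proof -
  have N: "inner x x \<noteq> 0" and fv: "first_variation x \<eta> = 0"
    using assms by (auto simp: critical_point_iff)
  have n6: "norm x ^ 6 = inner x x ^ 3"
    by (simp add: power2_norm_eq_inner[symmetric] flip: power_mult)
  show ?thesis
    using fv N unfolding first_variation_def alpha_def n6 power2_norm_eq_inner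
    by (simp add: field_simps power2_eq_square power3_eq_cube)
qed


lemma has_weak_deriv_test_fun:
  assumes "test_fun \<phi>"
  shows "has_weak_deriv (L2 \<phi>) (L2 (deriv \<phi>))"
  using assms test_fun_continuous[OF assms]
  by (intro has_weak_deriv_C1) (auto simp: test_fun_def)

lemma hessian_second_variation:
  assumes "critical_point x" "\<xi> \<in> W22" "test_fun \<phi>"
  shows "((\<lambda>s. deriv (\<lambda>t. action (x + s *\<^sub>R \<xi> + t *\<^sub>R L2 \<phi>)) 0) has_real_derivative
    4 * (norm x)\<^sup>2 * inner (hessian x \<xi>) (L2 \<phi>)) (at 0)"
proof -
  have x: "x \<in> W12" "x \<noteq> 0" using assms(1) by (auto simp: critical_point_def)
  have \<xi>: "\<xi> \<in> W12" "wderiv \<xi> \<in> W12" using assms(2) by (auto simp: W22_def)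
  define \<eta> where "\<eta> = L2 \<phi>"
  have \<eta>: "\<eta> \<in> W12" "wderiv \<eta> = L2 (deriv \<phi>)"
    using has_weak_deriv_test_fun[OF assms(3)] by (auto simp: \<eta>_def intro: W12_I wderiv_eqI)
  have x\<xi>: "x + s *\<^sub>R \<xi> \<in> W12" "wderiv (x + s *\<^sub>R \<xi>) = wderiv x + s *\<^sub>R wderiv \<xi>" for s
    using x \<xi> W12_add W12_scaleR by auto
  have "((\<lambda>s. x + s *\<^sub>R \<xi>) \<longlongrightarrow> x + 0 *\<^sub>R \<xi>) (nhds 0)"
    by (intro tendsto_intros filterlim_ident)
  then have "\<forall>\<^sub>F s in nhds 0. x + s *\<^sub>R \<xi> \<noteq> 0"
    using x(2) by (intro tendsto_imp_eventually_ne) simp_all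
  then have ev: "\<forall>\<^sub>F s in nhds 0. deriv (\<lambda>t. action (x + s *\<^sub>R \<xi> + t *\<^sub>R \<eta>)) 0
      = first_variation (x + s *\<^sub>R \<xi>) \<eta>"
    by eventually_elim (intro DERIV_imp_deriv action_has_derivative x\<xi> \<eta>(1))
  define N D b d e g h i j where defs: "N = inner x x" "D = inner (wderiv x) (wderiv x)"
    "b = inner x \<eta>" "d = inner (wderiv x) (wderiv \<eta>)"
    "e = inner x \<xi>" "g = inner (wderiv x) (wderiv \<xi>)"
    "h = inner \<xi> \<eta>" "i = inner (wderiv \<xi>) (wderiv \<eta>)"
    "j = - 2 * h / N\<^sup>2 + 8 * b * e / N ^ 3"
  have N: "N \<noteq> 0" using x by (simp add: defs)
  have fv: "first_variation (x + s *\<^sub>R \<xi>) \<eta> =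
      4 * (b + s * h) * (D + 2 * s * g + s\<^sup>2 * inner (wderiv \<xi>) (wderiv \<xi>))
      + 4 * (N + 2 * s * e + s\<^sup>2 * inner \<xi> \<xi>) * (d + s * i)
      - 2 * (b + s * h) / (N + 2 * s * e + s\<^sup>2 * inner \<xi> \<xi>)\<^sup>2" for s
  proof -
    have sq: "inner (u + s *\<^sub>R v) (u + s *\<^sub>R v) = inner u u + 2 * s * inner u v + s\<^sup>2 * inner v v" for u v :: l2
      by (simp add: inner_add_left inner_add_right inner_commute[of v u] power2_eq_square algebra_simps)
    show ?thesis
      unfolding first_variation_def x\<xi>(2) sq defs by (simp add: inner_add_left)
  qed
  have d: "d = - alpha x * b" and g: "g = - alpha x * e"
    using critical_point_weak_equation[OF assms(1)] \<eta>(1) \<xi>(1) by (auto simp: defs)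
  have "((\<lambda>s. first_variation (x + s *\<^sub>R \<xi>) \<eta>) has_real_derivative
      4 * h * D + 8 * b * g + 8 * e * d + 4 * N * i + j) (at 0)"
    unfolding fv
    using N by (auto intro!: derivative_eq_intros simp: defs(9) field_simps power2_eq_square power3_eq_cube)
  moreover have "4 * h * D + 8 * b * g + 8 * e * d + 4 * N * i + j = 4 * (norm x)\<^sup>2 * inner (hessian x \<xi>) \<eta>"
  proof -
    have "has_weak_deriv (wderiv \<xi>) (wderiv (wderiv \<xi>))"
      by (rule W12_has_weak_deriv[OF \<xi>(2)])
    then have parts: "inner (wderiv (wderiv \<xi>)) \<eta> = - i"
      using assms(3) unfolding defs \<eta>(2) has_weak_deriv_def by (simp add: \<eta>_def)
    have n6: "norm x ^ 6 = N ^ 3"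
      by (simp add: defs power2_norm_eq_inner[symmetric] flip: power_mult)
    have al: "alpha x = D / N - 1 / (2 * N ^ 3)"
      unfolding alpha_def n6 by (simp add: defs power2_norm_eq_inner)
    have D: "D = N * alpha x + 1 / (2 * N\<^sup>2)"
      unfolding al using N by (simp add: field_simps power2_eq_square power3_eq_cube)
    have hess: "inner (hessian x \<xi>) \<eta> = i + alpha x * h - 2 / N * (2 * alpha x - 1 / N ^ 3) * e * b"
      unfolding hessian_def n6 using parts
      by (simp add: inner_diff_left inner_add_left power2_norm_eq_inner) (simp add: defs)
    then show ?thesis
      using N unfolding hess D d g defs(9) power2_norm_eq_inner defs(1)[symmetric]
      by (simp add: field_simps power2_eq_square power3_eq_cube)
  qed
  moreover have "((\<lambda>s. deriv (\<lambda>t. action (x + s *\<^sub>R \<xi> + t *\<^sub>R \<eta>)) 0) has_real_derivative u) (at 0)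
      \<longleftrightarrow> ((\<lambda>s. first_variation (x + s *\<^sub>R \<xi>) \<eta>) has_real_derivative u) (at 0)" for u
    by (rule DERIV_cong_ev[OF refl ev refl])
  ultimately show ?thesis by (simp add: \<eta>_def)
qed

lemma critical_point_x_crit:
  assumes "k \<ge> 1"
  shows "critical_point (x_crit k)"
proof -
  define w where "w = 2 * pi * real k"
  have w: "w > 0" using assms by (simp add: w_def)
  define f where "f = (\<lambda>t. amp k * cos (w * t))"
  define f' where "f' = (\<lambda>t. - w * amp k * sin (w * t))"
  have x: "x_crit k = L2 f" by (simp add: x_crit_def f_def w_def)
  have tr: "trig f" "trig f'"
    using trig_cos_sin_mult[of k] trig_cmult unfolding f_def f'_def w_def by blast+
  then have tf: "test_fun f" "test_fun f'" by (auto intro: trig_test_fun)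
  note sq = test_fun_sq_integrable(1)[OF tf(1)] test_fun_sq_integrable(1)[OF tf(2)]
  have df: "deriv f = f'"
    by (rule ext, rule DERIV_imp_deriv) (auto simp: f_def f'_def intro!: derivative_eq_intros)
  have df': "deriv f' = (\<lambda>t. (- w\<^sup>2) * f t)"
    by (rule ext, rule DERIV_imp_deriv)
      (auto simp: f_def f'_def power2_eq_square intro!: derivative_eq_intros)
  have wd: "has_weak_deriv (L2 f) (L2 f')"
    using has_weak_deriv_test_fun[OF tf(1)] by (simp add: df)
  then have W: "x_crit k \<in> W12" "wderiv (x_crit k) = L2 f'"
    by (auto simp: x intro: W12_I wderiv_eqI)
  have weak: "inner (wderiv (x_crit k)) (wderiv \<eta>) = w\<^sup>2 * inner (x_crit k) \<eta>" if "\<eta> \<in> W12" for \<eta>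
  proof -
    have "inner \<eta> (L2 (deriv f')) = - inner (wderiv \<eta>) (L2 f')"
      using W12_has_weak_deriv[OF that] tf by (simp add: has_weak_deriv_def)
    moreover have "L2 (deriv f') = (- w\<^sup>2) *\<^sub>R L2 f"
      unfolding df' by (rule scaleR_L2[symmetric, OF sq(1)])
    ultimately show ?thesis
      unfolding x W(2)[unfolded x] by (simp add: inner_commute)
  qed
  have N: "inner (x_crit k) (x_crit k) = (amp k)\<^sup>2 / 2"
  proof -
    have sinw: "sin (2 * w) = 0"
      using sin_npi[of "4 * k"] by (simp add: w_def mult_ac)
    have "((\<lambda>t. f t * f t) has_integral
        (amp k)\<^sup>2 * (1 / 2 + sin (2 * w * 1) / (4 * w)) - (amp k)\<^sup>2 * (0 / 2 + sin (2 * w * 0) / (4 * w))) {0..1}"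
    proof (rule fundamental_theorem_of_calculus)
      fix t :: real
      have cd: "cos (2 * w * t) = 2 * (cos (w * t))\<^sup>2 - 1"
        using cos_double_cos[of "w * t"] by (simp add: mult.assoc)
      have "((\<lambda>t. (amp k)\<^sup>2 * (t / 2 + sin (2 * w * t) / (4 * w))) has_real_derivative
          (amp k)\<^sup>2 * (1 / 2 + cos (2 * w * t) / 2)) (at t within {0..1})"
        using w by (auto intro!: derivative_eq_intros)
      moreover have "(amp k)\<^sup>2 * (1 / 2 + cos (2 * w * t) / 2) = f t * f t"
        unfolding cd by (simp add: f_def power2_eq_square field_simps)
      ultimately have "((\<lambda>t. (amp k)\<^sup>2 * (t / 2 + sin (2 * w * t) / (4 * w))) has_real_derivative f t * f t) (at t within {0..1})"
        by simp
      then show "((\<lambda>t. (amp k)\<^sup>2 * (t / 2 + sin (2 * w * t) / (4 * w))) has_vector_derivative f t * f t) (at t within {0..1})"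
        by (simp add: has_real_derivative_iff_has_vector_derivative)
    qed simp
    then have "integral {0..1} (\<lambda>t. f t * f t) = (amp k)\<^sup>2 / 2"
      using sinw by (simp add: integral_unique)
    then show ?thesis
      unfolding x inner_L2[OF sq(1) sq(1)]
      by (subst lebesgue_integral_eq_integral) (auto intro: sq_integrable_integrable_mult sq)
  qed
  have a6: "amp k ^ 6 = 1 / (2 * (pi * real k)\<^sup>2)"
  proof -
    have "(2 powr (1/6)) ^ 6 = (2::real)" by (simp add: powr_power)
    moreover have "((pi * real k) powr (1/3)) ^ 6 = (pi * real k)\<^sup>2"
      using assms by (simp add: powr_power)
    ultimately show ?thesis
      by (simp only: amp_def power_divide power_mult_distrib power_one)
  qed
  define n where "n = inner (x_crit k) (x_crit k)"
  have n3: "4 * w\<^sup>2 * n ^ 3 = 1"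
  proof -
    have "n ^ 3 = amp k ^ 6 / 8"
      by (simp add: n_def N power_divide flip: power_mult)
    then show ?thesis
      using assms unfolding a6 w_def by (simp add: power_mult_distrib)
  qed
  then have n0: "n \<noteq> 0" by auto
  have "first_variation (x_crit k) \<eta> = 0" if "\<eta> \<in> W12" for \<eta>
    unfolding first_variation_def weak[OF that] weak[OF W(1)] n_def[symmetric]
  proof -
    have "1 / n\<^sup>2 = 4 * w\<^sup>2 * n"
      using n3 n0 by (simp add: field_simps power2_eq_square power3_eq_cube)
    then have "2 * b / n\<^sup>2 = 2 * b * (4 * w\<^sup>2 * n)" for b
      by (metis times_divide_eq_right mult.right_neutral)
    then show "4 * inner (x_crit k) \<eta> * (w\<^sup>2 * n) + 4 * n * (w\<^sup>2 * inner (x_crit k) \<eta>)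
        - 2 * inner (x_crit k) \<eta> / n\<^sup>2 = 0"
      by simp
  qed
  moreover have "x_crit k \<noteq> 0" using n0 by (auto simp: n_def)
  ultimately show ?thesis using W by (simp add: critical_point_iff)
qed

end

theory Submission
  imports Defs
begin

text \<open>
  Write \<open>\<omega> m = 2 * pi * m\<close>. Since \<open>x_k\<close> is critical and \<open>x_k'' = - (\<omega> k)\<^sup>2 x_k\<close>, the
  weak Euler-Lagrange equation forces \<open>\<alpha> = - (\<omega> k)\<^sup>2\<close> and \<open>1 / \<parallel>x_k\<parallel>\<^sup>6 = 4 (\<omega> k)\<^sup>2\<close>, so that
  \<open>A \<xi> = - \<xi>'' - (\<omega> k)\<^sup>2 \<xi> + 12 (\<omega> k)\<^sup>2 / \<parallel>x_k\<parallel>\<^sup>2 \<langle>x_k, \<xi>\<rangle> x_k\<close>.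
  This operator is diagonal in the Fourier basis: the modes \<open>cos (\<omega> m t)\<close> and \<open>sin (\<omega> m t)\<close> have
  eigenvalue \<open>(\<omega> m)\<^sup>2 - (\<omega> k)\<^sup>2\<close>, except that the rank one term raises the eigenvalue of \<open>x_k\<close>
  itself from \<open>0\<close> to \<open>12 (\<omega> k)\<^sup>2\<close>. The negative eigenvalues therefore belong to \<open>m < k\<close>; they are
  distinct, the one for \<open>m = 0\<close> is simple (constants) and the \<open>k - 1\<close> others are double, which gives
  \<open>1 + 2 (k - 1) = 2 k - 1\<close>.

  That there are no further eigenvectors follows by pairing \<open>A \<xi> = \<mu> \<xi>\<close> with the modes
  (\<open>inner_hessian_mode\<close>), which determines \<open>\<xi>\<close> because the modes are complete in \<open>l2\<close>
  (\<open>l2_eq_0_modes\<close>). No integral is computed except \<open>\<parallel>cos\<parallel>\<^sup>2 + \<parallel>sin\<parallel>\<^sup>2 = 1\<close>: the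
  orthogonality relations come from integration by parts, that is, from the definition of the weak
  derivative.
\<close>

section \<open>Fourier modes\<close>

text \<open>The angular frequency of the \<open>m\<close>-th mode, written \<open>\<omega> m\<close> above.\<close>

definition freq :: "nat \<Rightarrow> real"
  where "freq m = 2 * pi * real m"

text \<open>
  The Fourier modes of frequency \<open>m \<ge> 0\<close> as elements of \<open>l2\<close>, not normalised;
  \<open>sin_mode 0\<close> is the zero vector.
\<close>

definition cos_mode :: "nat \<Rightarrow> l2"
  where "cos_mode m = L2 (\<lambda>t. cos (freq m * t))"

definition sin_mode :: "nat \<Rightarrow> l2"
  where "sin_mode m = L2 (\<lambda>t. sin (freq m * t))"

lemma test_fun_modes: "test_fun (\<lambda>t. cos (freq m * t))" "test_fun (\<lambda>t. sin (freq m * t))"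
  using trig_cos_sin_mult[of m] unfolding freq_def by (auto intro: trig_test_fun)

lemma sq_integrable_modes:
  "sq_integrable (\<lambda>t. cos (freq m * t))" "sq_integrable (\<lambda>t. sin (freq m * t))"
  using test_fun_modes test_fun_sq_integrable(1) by blast+

lemma L2_deriv_modes:
  "L2 (deriv (\<lambda>t. cos (freq m * t))) = - freq m *\<^sub>R sin_mode m"
  "L2 (deriv (\<lambda>t. sin (freq m * t))) = freq m *\<^sub>R cos_mode m"
proof -
  have "deriv (\<lambda>t. cos (freq m * t)) = (\<lambda>t. - freq m * sin (freq m * t))"
    by (rule ext, rule DERIV_imp_deriv) (auto intro!: derivative_eq_intros)
  then show "L2 (deriv (\<lambda>t. cos (freq m * t))) = - freq m *\<^sub>R sin_mode m"
    by (simp only: sin_mode_def scaleR_L2[OF sq_integrable_modes(2)])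
  have "deriv (\<lambda>t. sin (freq m * t)) = (\<lambda>t. freq m * cos (freq m * t))"
    by (rule ext, rule DERIV_imp_deriv) (auto intro!: derivative_eq_intros)
  then show "L2 (deriv (\<lambda>t. sin (freq m * t))) = freq m *\<^sub>R cos_mode m"
    by (simp only: cos_mode_def scaleR_L2[OF sq_integrable_modes(1)])
qed

lemma modes_W12:
  "cos_mode m \<in> W12" "wderiv (cos_mode m) = - freq m *\<^sub>R sin_mode m"
  "sin_mode m \<in> W12" "wderiv (sin_mode m) = freq m *\<^sub>R cos_mode m"
  using has_weak_deriv_test_fun[OF test_fun_modes(1), of m]
    has_weak_deriv_test_fun[OF test_fun_modes(2), of m]
  unfolding L2_deriv_modes cos_mode_def[symmetric] sin_mode_def[symmetric]
  by (auto intro: W12_I dest: wderiv_eqI)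

lemma modes_W22:
  "cos_mode m \<in> W22" "wderiv (wderiv (cos_mode m)) = - (freq m)\<^sup>2 *\<^sub>R cos_mode m"
  "sin_mode m \<in> W22" "wderiv (wderiv (sin_mode m)) = - (freq m)\<^sup>2 *\<^sub>R sin_mode m"
  using W12_scaleR[OF modes_W12(1)[of m], of "freq m"]
    W12_scaleR[OF modes_W12(3)[of m], of "- freq m"] modes_W12[of m]
  by (auto simp: W22_def power2_eq_square)

text \<open>Integration by parts against the modes.\<close>

lemma inner_wderiv_modes:
  assumes "\<xi> \<in> W12"
  shows "inner (wderiv \<xi>) (cos_mode m) = freq m * inner \<xi> (sin_mode m)"
    "inner (wderiv \<xi>) (sin_mode m) = - freq m * inner \<xi> (cos_mode m)"
proof -
  have "inner \<xi> (L2 (deriv \<phi>)) = - inner (wderiv \<xi>) (L2 \<phi>)" if "test_fun \<phi>" for \<phi>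
    using W12_has_weak_deriv[OF assms] that by (simp add: has_weak_deriv_def)
  from this[OF test_fun_modes(1)[of m]] this[OF test_fun_modes(2)[of m]]
  show "inner (wderiv \<xi>) (cos_mode m) = freq m * inner \<xi> (sin_mode m)"
    "inner (wderiv \<xi>) (sin_mode m) = - freq m * inner \<xi> (cos_mode m)"
    unfolding L2_deriv_modes cos_mode_def[symmetric] sin_mode_def[symmetric] by simp_all
qed

lemma inner_wderiv2_modes:
  assumes "\<xi> \<in> W22" "v \<in> {cos_mode m, sin_mode m}"
  shows "inner (wderiv (wderiv \<xi>)) v = - (freq m)\<^sup>2 * inner \<xi> v"
  using assms inner_wderiv_modes[of \<xi> m] inner_wderiv_modes[of "wderiv \<xi>" m]
  by (auto simp: W22_def power2_eq_square)

lemma freq_pos: "m > 0 \<Longrightarrow> freq m > 0"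
  by (simp add: freq_def)

lemma freq_nonneg: "freq m \<ge> 0"
  by (simp add: freq_def)

lemma freq_sq_less_iff: "(freq m)\<^sup>2 < (freq n)\<^sup>2 \<longleftrightarrow> m < n"
proof -
  have "(freq m)\<^sup>2 < (freq n)\<^sup>2 \<longleftrightarrow> freq m < freq n"
    using power_mono_iff[of "freq n" "freq m" 2] freq_nonneg by (simp flip: not_le)
  also have "\<dots> \<longleftrightarrow> m < n"
    by (simp add: freq_def)
  finally show ?thesis .
qed

lemma freq_sq_eq_iff: "(freq m)\<^sup>2 = (freq n)\<^sup>2 \<longleftrightarrow> m = n"
  using freq_sq_less_iff[of m n] freq_sq_less_iff[of n m] by (cases m n rule: linorder_cases) auto

lemma sin_mode_0: "sin_mode 0 = 0"
  by (simp add: sin_mode_def zero_l2_def freq_def)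

text \<open>
  Modes of different frequency are eigenvectors of the symmetric operator \<open>\<xi> \<mapsto> \<xi>''\<close> for different
  eigenvalues.
\<close>

lemma modes_orthogonal:
  assumes "m \<noteq> n" "u \<in> {cos_mode m, sin_mode m}" "v \<in> {cos_mode n, sin_mode n}"
  shows "inner u v = 0"
proof -
  have "u \<in> W22" "wderiv (wderiv u) = - (freq m)\<^sup>2 *\<^sub>R u"
    using assms(2) modes_W22 by auto
  then have "(freq m)\<^sup>2 * inner u v = (freq n)\<^sup>2 * inner u v"
    using inner_wderiv2_modes[OF _ assms(3), of u] by simp
  then show ?thesis
    using assms(1) freq_sq_eq_iff by simp
qed

lemma cos_sin_mode_orthogonal: "inner (cos_mode m) (sin_mode m) = 0"
proof (cases "m = 0")
  case False
  then show ?thesis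
    using inner_wderiv_modes(1)[OF modes_W12(1), of m m] freq_pos[of m]
    by (simp add: modes_W12 inner_commute)
qed (simp add: sin_mode_0)

lemma inner_cos_sin_mode_same:
  assumes "m > 0"
  shows "inner (sin_mode m) (sin_mode m) = inner (cos_mode m) (cos_mode m)"
  using inner_wderiv_modes(2)[OF modes_W12(1), of m m] freq_pos[OF assms]
  by (simp add: modes_W12)

lemma inner_cos_mode_pos: "inner (cos_mode m) (cos_mode m) > 0"
proof -
  let ?c = "\<lambda>t. cos (freq m * t)" and ?s = "\<lambda>t. sin (freq m * t)"
  note i = sq_integrable_integrable_mult[OF sq_integrable_modes(1) sq_integrable_modes(1), of m m]
    sq_integrable_integrable_mult[OF sq_integrable_modes(2) sq_integrable_modes(2), of m m]
  have "inner (cos_mode m) (cos_mode m) + inner (sin_mode m) (sin_mode m)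
      = integral\<^sup>L circle (\<lambda>t. ?c t * ?c t + ?s t * ?s t)"
    unfolding Bochner_Integration.integral_add[OF i]
    by (simp add: cos_mode_def sin_mode_def inner_L2 sq_integrable_modes)
  also have "\<dots> = integral\<^sup>L circle (\<lambda>t. 1)"
    by (simp flip: power2_eq_square)
  also have "\<dots> = 1"
    by (simp add: measure_restrict_space)
  finally have "cos_mode m \<noteq> 0"
    using inner_cos_sin_mode_same[of m] sin_mode_0 by (cases "m = 0") auto
  then show ?thesis by simp
qed

lemma sin_mode_nonzero: "m > 0 \<Longrightarrow> sin_mode m \<noteq> 0"
  using inner_cos_sin_mode_same[of m] inner_cos_mode_pos[of m] by auto

lemma dim_modes: "dim {cos_mode m, sin_mode m} = (if m = 0 then 1 else 2)"
proof -
  have c: "cos_mode m \<noteq> 0" using inner_cos_mode_pos[of m] by auto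
  show ?thesis
  proof (cases "m = 0")
    case True
    have "dim {cos_mode m} = card {cos_mode m}"
      using c by (intro dim_eq_card_independent) simp
    moreover have "span {sin_mode m, cos_mode m} = span {cos_mode m}"
      using True by (simp add: sin_mode_0)
    then have "dim {sin_mode m, cos_mode m} = dim {cos_mode m}"
      by (metis dim_span)
    ultimately show ?thesis using True by (simp add: insert_commute)
  next
    case False
    have "sin_mode m \<notin> span {cos_mode m}"
    proof
      assume "sin_mode m \<in> span {cos_mode m}"
      then obtain a where a: "sin_mode m = a *\<^sub>R cos_mode m"
        by (auto simp: span_singleton)
      then have "a * inner (cos_mode m) (cos_mode m) = 0"
        using cos_sin_mode_orthogonal[of m] by simp
      then show False
        using a c False sin_mode_nonzero[of m] by simp
    qed
    then have "independent {sin_mode m, cos_mode m}" "sin_mode m \<noteq> cos_mode m"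
      using c by (auto simp: independent_insert span_base)
    then show ?thesis
      using False dim_eq_card_independent[of "{sin_mode m, cos_mode m}"]
      by (simp add: insert_commute)
  qed
qed


section \<open>Completeness of the modes\<close>

text \<open>
  Linear combinations of the functions \<open>cos (freq m * t)\<close> and \<open>sin (freq m * t)\<close>. By the
  product-to-sum formulas they form an algebra, hence exhaust \<open>trig\<close>.
\<close>

inductive fourier_sum :: "(real \<Rightarrow> real) \<Rightarrow> bool" where
  cos: "fourier_sum (\<lambda>t. cos (freq m * t))"
| sin: "fourier_sum (\<lambda>t. sin (freq m * t))"
| add: "fourier_sum f \<Longrightarrow> fourier_sum g \<Longrightarrow> fourier_sum (\<lambda>t. f t + g t)"
| cmult: "fourier_sum f \<Longrightarrow> fourier_sum (\<lambda>t. c * f t)"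

lemma fourier_sum_diff:
  "fourier_sum f \<Longrightarrow> fourier_sum g \<Longrightarrow> fourier_sum (\<lambda>t. f t - g t)"
  using fourier_sum.add[OF _ fourier_sum.cmult[of g "-1"], of f] by simp

lemma fourier_sum_freq_diff:
  "fourier_sum (\<lambda>t. cos (freq m * t - freq n * t))"
  "fourier_sum (\<lambda>t. sin (freq m * t - freq n * t))"
proof -
  have "fourier_sum (\<lambda>t. cos (freq m * t - freq n * t)) \<and>
      fourier_sum (\<lambda>t. sin (freq m * t - freq n * t))"
  proof (cases "n \<le> m")
    case True
    then have "freq m * t - freq n * t = freq (m - n) * t" for t
      by (simp add: freq_def of_nat_diff algebra_simps)
    then show ?thesis by (simp add: fourier_sum.cos fourier_sum.sin)
  next
    case False
    then have "freq m * t - freq n * t = - (freq (n - m) * t)" for t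
      by (simp add: freq_def of_nat_diff algebra_simps)
    then show ?thesis
      using fourier_sum.cmult[OF fourier_sum.sin[of "n - m"], of "-1"]
      by (simp add: fourier_sum.cos)
  qed
  then show "fourier_sum (\<lambda>t. cos (freq m * t - freq n * t))"
    "fourier_sum (\<lambda>t. sin (freq m * t - freq n * t))" by auto
qed

lemma fourier_sum_freq_add:
  "fourier_sum (\<lambda>t. cos (freq m * t + freq n * t))"
  "fourier_sum (\<lambda>t. sin (freq m * t + freq n * t))"
  using fourier_sum.cos[of "m + n"] fourier_sum.sin[of "m + n"]
  by (simp_all add: freq_def algebra_simps)

lemma fourier_sum_mult_mode:
  assumes "fourier_sum f"
  shows "fourier_sum (\<lambda>t. f t * cos (freq n * t)) \<and> fourier_sum (\<lambda>t. f t * sin (freq n * t))"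
  using assms
proof (induction rule: fourier_sum.induct)
  case (cos m)
  have "fourier_sum (\<lambda>t. (1/2) * (cos (freq m * t - freq n * t) + cos (freq m * t + freq n * t)))"
    "fourier_sum (\<lambda>t. (1/2) * (sin (freq m * t + freq n * t) - sin (freq m * t - freq n * t)))"
    by (intro fourier_sum.cmult fourier_sum.add fourier_sum_diff fourier_sum_freq_diff
        fourier_sum_freq_add)+
  then show ?case by (simp add: cos_add cos_diff sin_add sin_diff)
next
  case (sin m)
  have "fourier_sum (\<lambda>t. (1/2) * (sin (freq m * t + freq n * t) + sin (freq m * t - freq n * t)))"
    "fourier_sum (\<lambda>t. (1/2) * (cos (freq m * t - freq n * t) - cos (freq m * t + freq n * t)))"
    by (intro fourier_sum.cmult fourier_sum.add fourier_sum_diff fourier_sum_freq_diff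
        fourier_sum_freq_add)+
  then show ?case by (simp add: cos_add cos_diff sin_add sin_diff mult.commute)
next
  case (add f g)
  then show ?case by (auto simp: distrib_right intro: fourier_sum.add)
next
  case (cmult f c)
  then show ?case by (auto simp: mult.assoc intro: fourier_sum.cmult)
qed

lemma fourier_sum_mult:
  assumes "fourier_sum g" "fourier_sum f"
  shows "fourier_sum (\<lambda>t. f t * g t)"
  using assms
proof (induction rule: fourier_sum.induct)
  case (add g h)
  then show ?case by (auto simp: distrib_left intro: fourier_sum.add)
next
  case (cmult g c)
  then show ?case
    using fourier_sum.cmult[of "\<lambda>t. f t * g t" c] by (simp add: mult.left_commute)
qed (simp_all add: fourier_sum_mult_mode)

lemma trig_fourier_sum: "trig f \<Longrightarrow> fourier_sum f"
proof (induction rule: trig.induct)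
  case (const c)
  show ?case using fourier_sum.cmult[OF fourier_sum.cos[of 0], of c] by (simp add: freq_def)
next
  case cos
  show ?case using fourier_sum.cos[of 1] by (simp add: freq_def)
next
  case sin
  show ?case using fourier_sum.sin[of 1] by (simp add: freq_def)
qed (auto intro: fourier_sum.add fourier_sum_mult)

lemma fourier_sum_orthogonal:
  assumes "fourier_sum f"
    and "\<And>m. inner x (cos_mode m) = 0" "\<And>m. inner x (sin_mode m) = 0"
  shows "sq_integrable f \<and> inner x (L2 f) = 0"
  using assms(1)
proof (induction rule: fourier_sum.induct)
  case (cos m)
  show ?case using assms(2)[of m] by (simp add: cos_mode_def sq_integrable_modes)
next
  case (sin m)
  show ?case using assms(3)[of m] by (simp add: sin_mode_def sq_integrable_modes)
next
  case (add f g)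
  then have "L2 (\<lambda>t. f t + g t) = L2 f + L2 g"
    by (simp add: plus_l2.abs_eq l2_rel_def)
  with add show ?case by (simp add: sq_integrable_add inner_add_right)
next
  case (cmult f c)
  then have "L2 (\<lambda>t. c * f t) = c *\<^sub>R L2 f"
    by (simp add: scaleR_L2)
  with cmult show ?case by (simp add: sq_integrable_cmult)
qed

lemma l2_eq_0_modes:
  assumes "\<And>m v. v \<in> {cos_mode m, sin_mode m} \<Longrightarrow> inner x v = 0"
  shows "x = 0"
  using assms fourier_sum_orthogonal[OF trig_fourier_sum] by (intro l2_eq_0I) blast


section \<open>The Hessian in the basis of modes\<close>

lemma x_crit_cos_mode: "x_crit k = amp k *\<^sub>R cos_mode k"
  by (simp add: x_crit_def cos_mode_def freq_def scaleR_L2[OF sq_integrable_modes(1), unfolded freq_def])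

text \<open>
  Both identities come from the fact that \<open>x_crit k\<close> is critical, so the explicit value of
  \<open>amp k\<close> does not enter.
\<close>

lemma x_crit_constants:
  assumes "k \<ge> 1"
  shows "x_crit k \<noteq> 0" "alpha (x_crit k) = - (freq k)\<^sup>2" "1 / norm (x_crit k) ^ 6 = 4 * (freq k)\<^sup>2"
proof -
  let ?x = "x_crit k"
  have crit: "critical_point ?x" by (rule critical_point_x_crit[OF assms])
  then show nz: "?x \<noteq> 0" by (simp add: critical_point_def)
  have W: "?x \<in> W12" using crit by (simp add: critical_point_def)
  have n: "inner ?x ?x \<noteq> 0" using nz by simp
  have "wderiv ?x = (- amp k * freq k) *\<^sub>R sin_mode k"
    using W12_scaleR[OF modes_W12(1)[of k], of "amp k"] by (simp add: x_crit_cos_mode modes_W12)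
  then have energy: "inner (wderiv ?x) (wderiv ?x) = (freq k)\<^sup>2 * inner ?x ?x"
    using inner_cos_sin_mode_same[of k] assms by (simp add: x_crit_cos_mode power2_eq_square)
  then have "(- alpha ?x) * inner ?x ?x = (freq k)\<^sup>2 * inner ?x ?x"
    using critical_point_weak_equation[OF crit W] by simp
  then have "- alpha ?x = (freq k)\<^sup>2"
    using n mult_right_cancel by blast
  then show a: "alpha ?x = - (freq k)\<^sup>2" by simp
  have "alpha ?x = (freq k)\<^sup>2 - 1 / (2 * norm ?x ^ 6)"
    using energy n by (simp add: alpha_def power2_norm_eq_inner)
  then show "1 / norm ?x ^ 6 = 4 * (freq k)\<^sup>2"
    using a by simp
qed

lemma hessian_x_crit:
  assumes "k \<ge> 1"
  shows "hessian (x_crit k) \<xi> = - wderiv (wderiv \<xi>) - (freq k)\<^sup>2 *\<^sub>R \<xi>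
    + (12 * (freq k)\<^sup>2 / (norm (x_crit k))\<^sup>2 * inner (x_crit k) \<xi>) *\<^sub>R x_crit k"
  unfolding hessian_def x_crit_constants[OF assms] by (simp add: field_simps)

lemma x_crit_orthogonal:
  assumes "v \<in> {cos_mode m, sin_mode m}" "v \<noteq> cos_mode k"
  shows "inner (x_crit k) v = 0"
  using assms modes_orthogonal[of k m "cos_mode k" v] cos_sin_mode_orthogonal[of k]
  by (cases "m = k") (auto simp: x_crit_cos_mode)

text \<open>
  The weak form of the statement that the modes diagonalise the Hessian; it applies to every
  \<open>\<xi>\<close> in the domain and needs no regularity beyond \<open>W22\<close>.
\<close>

lemma inner_hessian_mode:
  assumes "k \<ge> 1" "\<xi> \<in> W22" "v \<in> {cos_mode m, sin_mode m}"
  shows "inner (hessian (x_crit k) \<xi>) v =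
    (if v = cos_mode k then 12 * (freq k)\<^sup>2 else (freq m)\<^sup>2 - (freq k)\<^sup>2) * inner \<xi> v"
proof -
  have D: "inner (wderiv (wderiv \<xi>)) v = - (freq m)\<^sup>2 * inner \<xi> v"
    by (rule inner_wderiv2_modes[OF assms(2,3)])
  show ?thesis
  proof (cases "v = cos_mode k")
    case True
    have a: "amp k \<noteq> 0"
      using x_crit_constants(1)[OF assms(1)] by (auto simp: x_crit_cos_mode)
    have "inner (wderiv (wderiv \<xi>)) v = - (freq k)\<^sup>2 * inner \<xi> v"
      using inner_wderiv2_modes[OF assms(2), of v k] True by simp
    then show ?thesis
      using True a inner_cos_mode_pos[of k] unfolding hessian_x_crit[OF assms(1)] power2_norm_eq_inner
      by (simp add: x_crit_cos_mode inner_diff_left inner_add_left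
          inner_commute[of "cos_mode k" \<xi>] power2_eq_square power_mult_distrib
          field_simps)
  next
    case False
    then show ?thesis
      using D x_crit_orthogonal[OF assms(3) False]
      by (simp add: hessian_x_crit[OF assms(1)] inner_diff_left inner_add_left algebra_simps)
  qed
qed

text \<open>
  An eigenvector for \<open>\<mu> < 0\<close> is orthogonal to every mode of a different eigenvalue. This includes
  \<open>cos_mode k\<close>, whose eigenvalue \<open>12 (freq k)\<^sup>2\<close> is positive.
\<close>

lemma eigenvector_orthogonal_mode:
  assumes "k \<ge> 1" "\<mu> < 0" "\<xi> \<in> eigenspace W22 (hessian (x_crit k)) \<mu>"
    and "v \<in> {cos_mode m, sin_mode m}" "\<mu> \<noteq> (freq m)\<^sup>2 - (freq k)\<^sup>2"
  shows "inner \<xi> v = 0"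
proof -
  have "\<mu> * inner \<xi> v = (if v = cos_mode k then 12 * (freq k)\<^sup>2 else (freq m)\<^sup>2 - (freq k)\<^sup>2) * inner \<xi> v"
    using inner_hessian_mode[OF assms(1) _ assms(4), of \<xi>] assms(3) by (simp add: eigenspace_def)
  moreover have "\<mu> \<noteq> 12 * (freq k)\<^sup>2"
    using assms(2) zero_le_power2[of "freq k"] by linarith
  ultimately show ?thesis
    using assms(5) by (auto split: if_splits)
qed

lemma eigenspace_hessian:
  assumes "k \<ge> 1" "m < k"
  shows "eigenspace W22 (hessian (x_crit k)) ((freq m)\<^sup>2 - (freq k)\<^sup>2) = span {cos_mode m, sin_mode m}"
    (is "?E = _")
proof
  let ?\<mu> = "(freq m)\<^sup>2 - (freq k)\<^sup>2"
  let ?B = "{cos_mode m, sin_mode m}"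
  have neg: "?\<mu> < 0" using assms(2) freq_sq_less_iff[of m k] by simp
  show "?E \<subseteq> span ?B"
  proof
    fix \<xi> assume \<xi>: "\<xi> \<in> ?E"
    \<comment> \<open>For \<open>m = 0\<close> the coefficient \<open>b\<close> is a division by zero, harmless because \<open>sin_mode 0 = 0\<close>.\<close>
    define a where "a = inner \<xi> (cos_mode m) / inner (cos_mode m) (cos_mode m)"
    define b where "b = inner \<xi> (sin_mode m) / inner (sin_mode m) (sin_mode m)"
    have "\<xi> - (a *\<^sub>R cos_mode m + b *\<^sub>R sin_mode m) = 0"
    proof (rule l2_eq_0_modes)
      fix n v assume v: "v \<in> {cos_mode n, sin_mode n}"
      show "inner (\<xi> - (a *\<^sub>R cos_mode m + b *\<^sub>R sin_mode m)) v = 0"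
      proof (cases "n = m")
        case True
        have "inner \<xi> (sin_mode m) = b * inner (sin_mode m) (sin_mode m)"
          by (cases "sin_mode m = 0") (simp_all add: b_def)
        moreover have "inner \<xi> (cos_mode m) = a * inner (cos_mode m) (cos_mode m)"
          using inner_cos_mode_pos[of m] by (simp add: a_def)
        ultimately show ?thesis
          using v True cos_sin_mode_orthogonal[of m]
          by (auto simp: inner_diff_left inner_add_left inner_commute[of "sin_mode m" "cos_mode m"])
      next
        case False
        then have "inner \<xi> v = 0"
          using eigenvector_orthogonal_mode[OF assms(1) neg \<xi> v] freq_sq_eq_iff[of m n] by auto
        moreover have "inner (cos_mode m) v = 0" "inner (sin_mode m) v = 0"
          using modes_orthogonal[of m n _ v] v False by auto
        ultimately show ?thesis by (simp add: inner_diff_left inner_add_left)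
      qed
    qed
    then have "\<xi> = a *\<^sub>R cos_mode m + b *\<^sub>R sin_mode m" by simp
    then show "\<xi> \<in> span ?B" by (auto intro!: span_add span_scale intro: span_base)
  qed
  show "span ?B \<subseteq> ?E"
  proof
    fix \<xi> assume "\<xi> \<in> span ?B"
    then obtain a b where \<xi>: "\<xi> = a *\<^sub>R cos_mode m + b *\<^sub>R sin_mode m"
      by (auto simp: span_insert algebra_simps)
    have W: "cos_mode m \<in> W12" "sin_mode m \<in> W12" by (rule modes_W12)+
    have W': "wderiv (cos_mode m) \<in> W12" "wderiv (sin_mode m) \<in> W12"
      using modes_W22 by (auto simp: W22_def)
    have d: "\<xi> \<in> W12" "wderiv \<xi> = a *\<^sub>R wderiv (cos_mode m) + b *\<^sub>R wderiv (sin_mode m)"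
      using W12_add[of "a *\<^sub>R cos_mode m" "b *\<^sub>R sin_mode m"] W12_scaleR[OF W(1), of a]
        W12_scaleR[OF W(2), of b] unfolding \<xi> by auto
    have d2: "wderiv \<xi> \<in> W12" "wderiv (wderiv \<xi>) = - (freq m)\<^sup>2 *\<^sub>R \<xi>"
      using W12_add[of "a *\<^sub>R wderiv (cos_mode m)" "b *\<^sub>R wderiv (sin_mode m)"]
        W12_scaleR[OF W'(1), of a] W12_scaleR[OF W'(2), of b] modes_W22[of m]
      unfolding d(2) by (auto simp: \<xi> scaleR_add_right mult.commute)
    have "inner (cos_mode k) (cos_mode m) = 0" "inner (cos_mode k) (sin_mode m) = 0"
      using modes_orthogonal[of k m "cos_mode k"] assms(2) by auto
    then have "inner (x_crit k) \<xi> = 0"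
      by (simp add: \<xi> x_crit_cos_mode inner_add_right)
    then have "hessian (x_crit k) \<xi> = ?\<mu> *\<^sub>R \<xi>"
      unfolding hessian_x_crit[OF assms(1)] d2(2) by (simp add: scaleR_left_diff_distrib)
    then show "\<xi> \<in> ?E" using d(1) d2(1) by (simp add: eigenspace_def W22_def)
  qed
qed

lemma multiplicity_hessian:
  assumes "k \<ge> 1" "m < k"
  shows "multiplicity_of W22 (hessian (x_crit k)) ((freq m)\<^sup>2 - (freq k)\<^sup>2)
    = enat (if m = 0 then 1 else 2)"
proof -
  have "\<exists>B. finite B \<and> span {cos_mode m, sin_mode m} \<subseteq> span B"
    by (intro exI[of _ "{cos_mode m, sin_mode m}"]) simp
  then show ?thesis
    unfolding multiplicity_of_def eigenspace_hessian[OF assms] dim_span dim_modes by simp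
qed

lemma negative_eigenvalues_hessian:
  assumes "k \<ge> 1"
  shows "{\<mu> \<in> eigenvalues W22 (hessian (x_crit k)). \<mu> < 0} = (\<lambda>m. (freq m)\<^sup>2 - (freq k)\<^sup>2) ` {..<k}"
    (is "?N = _")
proof
  show "?N \<subseteq> (\<lambda>m. (freq m)\<^sup>2 - (freq k)\<^sup>2) ` {..<k}"
  proof
    fix \<mu> assume "\<mu> \<in> ?N"
    then obtain \<xi> where neg: "\<mu> < 0" and nz: "\<xi> \<noteq> 0"
      and \<xi>: "\<xi> \<in> eigenspace W22 (hessian (x_crit k)) \<mu>"
      by (auto simp: eigenvalues_def eigenspace_def)
    obtain m where m: "\<mu> = (freq m)\<^sup>2 - (freq k)\<^sup>2"
      using eigenvector_orthogonal_mode[OF assms neg \<xi>] l2_eq_0_modes[of \<xi>] nz by metis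
    with neg have "m < k" using freq_sq_less_iff[of m k] by simp
    with m show "\<mu> \<in> (\<lambda>m. (freq m)\<^sup>2 - (freq k)\<^sup>2) ` {..<k}" by auto
  qed
  show "(\<lambda>m. (freq m)\<^sup>2 - (freq k)\<^sup>2) ` {..<k} \<subseteq> ?N"
  proof clarify
    fix m assume m: "m < k"
    have "cos_mode m \<noteq> 0" using inner_cos_mode_pos[of m] by auto
    moreover have "cos_mode m \<in> eigenspace W22 (hessian (x_crit k)) ((freq m)\<^sup>2 - (freq k)\<^sup>2)"
      unfolding eigenspace_hessian[OF assms m] by (simp add: span_base)
    ultimately show "(freq m)\<^sup>2 - (freq k)\<^sup>2 \<in> eigenvalues W22 (hessian (x_crit k)) \<and>
        (freq m)\<^sup>2 - (freq k)\<^sup>2 < 0"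
      using m freq_sq_less_iff[of m k] by (auto simp: eigenvalues_def eigenspace_def)
  qed
qed

lemma sum_mode_multiplicities:
  assumes "k \<ge> 1"
  shows "(\<Sum>m<k. enat (if m = 0 then 1 else 2)) = enat (2 * k - 1)"
  using assms by (induction k rule: dec_induct) auto

theorem proposition3p7:
  fixes k :: nat
  assumes "k \<ge> 1"
  shows "odd (the_enat (morse_index (x_crit k))) \<and> morse_index (x_crit k) = enat (2 * k - 1)"
proof -
  let ?ev = "\<lambda>m. (freq m)\<^sup>2 - (freq k)\<^sup>2"
  have "inj_on ?ev {..<k}" by (auto simp: inj_on_def freq_sq_eq_iff)
  then have "morse_index (x_crit k) = (\<Sum>m<k. multiplicity_of W22 (hessian (x_crit k)) (?ev m))"
    unfolding morse_index_def Let_def negative_eigenvalues_hessian[OF assms]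
    by (simp add: sum.reindex)
  also have "\<dots> = (\<Sum>m<k. enat (if m = 0 then 1 else 2))"
    using multiplicity_hessian[OF assms] by (intro sum.cong) auto
  also have "\<dots> = enat (2 * k - 1)"
    by (rule sum_mode_multiplicities[OF assms])
  finally show ?thesis using assms by simp
qed

end
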